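(* Let $H^{\alpha,c,N}_{n,m,x}=\det\left(h^{\alpha,c,N}_{m+j-1}(x+i-1)\right)_{i,j=1}^n$. For $n,m\ge0$ and $\alpha+c-N\ne-1,-2,\dots$, we have $$H^{\alpha,c-n-m,N+n+m}_{n,m,x}=(-1)^{nm}\,H^{-\alpha,2-c,-N}_{m,n,-x}.$$
   Context: The parameters $\alpha,c,N$ are real and $n,m$ are integers. For $\alpha+c-N\neq-1,-2,\dots$ the (normalized) Hahn polynomials are $$h_k^{\alpha,c,N}(x)=\frac1{k!}\sum_{j=0}^k\frac{(1-N+j)_{k-j}(c+j)_{k-j}}{(k+\alpha+c-N+j)_{k-j}}\binom kj\binom xj j!,\qquad k\ge0,$$ where $(u)_l=u(u+1)\cdots(u+l-1)$, $(u)_0=1$. A $0\times0$ determinant equals $1$.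
   Formalization: The stated condition on α+c−N does not prevent zero denominators in the shifted Hahn polynomials (e.g. n=1, m=2, α+c−N=3); it is also assumed that no denominator vanishes in the formulas for the polynomials occurring as entries of the two determinants. *)

theory Defs
  imports Complex_Main "Jordan_Normal_Form.Determinant"
begin

text \<open>
  The parameters are real. The argument is taken in an arbitrary real field, so that it may
  be a real or a complex number. The binomial coefficient of \<open>x\<close> over \<open>j\<close> is the generalized
  one, \<open>x (x - 1) \<dots> (x - j + 1) / j!\<close>.
\<close>

definition hahn :: "real \<Rightarrow> real \<Rightarrow> real \<Rightarrow> nat \<Rightarrow> 'a::real_field \<Rightarrow> 'a" where
  "hahn \<alpha> c N k x =
     1 / fact k *
     (\<Sum>j=0..k.
        of_real (pochhammer (1 - N + real j) (k - j) * pochhammer (c + real j) (k - j)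
                 / pochhammer (real k + \<alpha> + c - N + real j) (k - j))
        * of_nat (k choose j) * (x gchoose j) * fact j)"

text \<open>
  No denominator in the formula for the polynomial of degree \<open>k\<close> vanishes. This holds for all
  \<open>k\<close> if and only if \<open>\<alpha> + c - N\<close> is not a negative integer.
  It has to be required separately for shifted parameters: if \<open>\<alpha> + c - N\<close> is not a negative
  integer, \<open>\<alpha> + (c - d) - (N + d)\<close> may still be one, and Isabelle's division by zero would then
  give a meaningless value.
\<close>

definition hahn_defined :: "real \<Rightarrow> real \<Rightarrow> real \<Rightarrow> nat \<Rightarrow> bool" where
  "hahn_defined \<alpha> c N k \<longleftrightarrow>
     (\<forall>j\<le>k. pochhammer (real k + \<alpha> + c - N + real j) (k - j) \<noteq> 0)"

text \<open>Row and column indices start at 0 here, so the entry \<open>(i, j)\<close> has degree \<open>m + j\<close> and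
  argument \<open>x + i\<close>. The determinant of the empty matrix is 1.\<close>

definition hahn_det :: "real \<Rightarrow> real \<Rightarrow> real \<Rightarrow> nat \<Rightarrow> nat \<Rightarrow> 'a::real_field \<Rightarrow> 'a" where
  "hahn_det \<alpha> c N n m x =
     det (mat n n (\<lambda>(i, j). hahn \<alpha> c N (m + j) (x + of_nat i)))"

end

theory Submission
  imports Defs "HOL-Computational_Algebra.Formal_Power_Series"
begin

text \<open>
  Since the forward difference in \<open>x\<close> of \<open>h\<^sub>k\<close> with parameters \<open>(\<alpha>, c, N)\<close> is \<open>h\<^sub>k\<^sub>-\<^sub>1\<close> with
  parameters \<open>(\<alpha>, c + 1, N - 1)\<close>, taking differences of rows turns the left-hand determinant into
  the minor with rows \<open>i < n\<close> and columns \<open>l \<ge> m\<close> of the unitriangular matrix \<open>M\<close> of size \<open>n + m\<close>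
  whose entry \<open>(i, l)\<close> is \<open>h\<^sub>l\<^sub>-\<^sub>i(x)\<close> with parameters \<open>(\<alpha>, C + i, N' - i)\<close>, where \<open>C = c - n - m\<close>
  and \<open>N' = N + n + m\<close>. The inverse of \<open>M\<close> has the entry \<open>h\<^sub>l\<^sub>-\<^sub>i(-x)\<close> with parameters
  \<open>(-\<alpha>, 1 - C - l, 1 - N' + l)\<close>: in the product, the numerators depend only on the outer indices,
  the denominators sum to zero off the diagonal by a telescoping identity, and what remains is
  Vandermonde's convolution for \<open>x\<close> and \<open>-x\<close>. Jacobi's complementary minor theorem expresses the
  minor of \<open>M\<close> by one of the inverse, which after reflection in the antidiagonal is the right-hand
  determinant.
\<close>

section \<open>Binomial expansion and forward differences\<close>

text \<open>The coefficient of \<open>x gchoose j\<close>: \<open>1 / fact k\<close>,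
  \<open>k choose j\<close> and \<open>fact j\<close> combine to
  \<open>1 / fact (k - j)\<close>.\<close>

definition hahn_coeff :: "real \<Rightarrow> real \<Rightarrow> real \<Rightarrow> nat \<Rightarrow> nat \<Rightarrow> real" where
  "hahn_coeff \<alpha> c N k j =
     pochhammer (1 - N + real j) (k - j) * pochhammer (c + real j) (k - j)
       / (pochhammer (real k + \<alpha> + c - N + real j) (k - j) * fact (k - j))"

lemma hahn_altdef:
  fixes x :: "'a::real_field"
  shows "hahn \<alpha> c N k x = (\<Sum>j\<le>k. of_real (hahn_coeff \<alpha> c N k j) * (x gchoose j))"
proof -
  have "1 / fact k * (of_real (pochhammer (1 - N + real j) (k - j) * pochhammer (c + real j) (k - j)
                 / pochhammer (real k + \<alpha> + c - N + real j) (k - j))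
        * of_nat (k choose j) * (x gchoose j) * fact j)
      = of_real (hahn_coeff \<alpha> c N k j) * (x gchoose j)" if "j \<le> k" for j
  proof -
    have "of_nat (k choose j) = (fact k / (fact j * fact (k - j)) :: 'a)"
      using that by (rule binomial_fact)
    then show ?thesis
      by (simp add: hahn_coeff_def)
  qed
  then show ?thesis
    unfolding hahn_def sum_distrib_left by (intro sum.cong) (auto simp: atLeast0AtMost)
qed

lemma hahn_0 [simp]: "hahn \<alpha> c N 0 x = 1"
  by (simp add: hahn_def)

text \<open>Raising \<open>k\<close> and \<open>j\<close> by one has the same effect on a
  coefficient as passing to \<open>c + 1\<close> and \<open>N - 1\<close>; Pascal's rule does the
  rest.\<close>

lemma hahn_Suc_plus_1:
  fixes x :: "'a::real_field"
  shows "hahn \<alpha> c N (Suc k) (x + 1) = hahn \<alpha> c N (Suc k) x + hahn \<alpha> (c + 1) (N - 1) k x"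
proof -
  have coeff: "hahn_coeff \<alpha> c N (Suc k) (Suc j) = hahn_coeff \<alpha> (c + 1) (N - 1) k j" for j
    by (simp add: hahn_coeff_def algebra_simps)
  show ?thesis
    unfolding hahn_altdef
    by (simp add: sum.atMost_Suc_shift coeff gbinomial_Suc_Suc sum.distrib ring_distribs del: sum.atMost_Suc)
qed

text \<open>Newton's forward difference formula. Differences of order beyond the degree vanish,
  whereas \<open>k - p\<close> would truncate to 0 and give 1; hence the case distinction.\<close>

lemma hahn_plus_of_nat:
  fixes x :: "'a::real_field"
  shows "hahn \<alpha> c N k (x + of_nat i) =
    (\<Sum>p\<le>i. of_nat (i choose p) *
       (if p \<le> k then hahn \<alpha> (c + real p) (N - real p) (k - p) x else 0))"
proof (induction i arbitrary: c N k)
  case 0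
  then show ?case by simp
next
  case (Suc i)
  show ?case
  proof (cases k)
    case 0
    then show ?thesis
      by (simp add: sum.atMost_Suc_shift del: sum.atMost_Suc)
  next
    case (Suc k')
    define g where "g p = (if p \<le> k then hahn \<alpha> (c + real p) (N - real p) (k - p) x else 0)" for p
    have g': "g (Suc p) = (if p \<le> k' then hahn \<alpha> (c + 1 + real p) (N - 1 - real p) (k' - p) x else 0)" for p
      by (simp add: g_def Suc algebra_simps)
    have "hahn \<alpha> c N k (x + of_nat (Suc i))
        = hahn \<alpha> c N k (x + of_nat i) + hahn \<alpha> (c + 1) (N - 1) k' (x + of_nat i)"
      using hahn_Suc_plus_1[of \<alpha> c N k' "x + of_nat i"] by (simp add: Suc algebra_simps)
    also have "\<dots> = (\<Sum>p\<le>i. of_nat (i choose p) * g p) + (\<Sum>p\<le>i. of_nat (i choose p) * g (Suc p))"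
      unfolding Suc.IH g' by (simp add: g_def)
    also have "(\<Sum>p\<le>i. of_nat (i choose p) * g p) = (\<Sum>p\<le>Suc i. of_nat (i choose p) * g p)"
      by simp
    also have "\<dots> = g 0 + (\<Sum>p\<le>i. of_nat (i choose Suc p) * g (Suc p))"
      by (simp add: sum.atMost_Suc_shift del: sum.atMost_Suc)
    also have "g 0 + (\<Sum>p\<le>i. of_nat (i choose Suc p) * g (Suc p)) + (\<Sum>p\<le>i. of_nat (i choose p) * g (Suc p))
       = (\<Sum>p\<le>Suc i. of_nat (Suc i choose p) * g p)"
      by (simp add: sum.atMost_Suc_shift sum.distrib algebra_simps del: sum.atMost_Suc)
    finally show ?thesis by (simp add: g_def)
  qed
qed

section \<open>A telescoping identity for the denominators\<close>

text \<open>
  The last summand is left out because splitting it would divide by \<open>a + 2 p\<close>, which may vanish.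
\<close>

lemma sum_well_poised_partial:
  fixes a :: "'a::field_char_0"
  assumes "k < p" and nz: "\<And>u. 1 \<le> u \<Longrightarrow> u < 2 * p \<Longrightarrow> a + of_nat u \<noteq> 0"
  shows "(\<Sum>q\<le>k. (- 1) ^ q * of_nat (p choose q) /
            (pochhammer (a + of_nat q) q * pochhammer (a + 1 + 2 * of_nat q) (p - q)))
    = (- 1) ^ k * of_nat ((p - 1) choose k) / pochhammer (a + 1 + of_nat k) p"
  using assms(1)
proof (induction k)
  case 0
  then show ?case by simp
next
  case (Suc k)
  define b where "b = a + 1 + of_nat k"
  obtain P where P: "p = Suc P" using Suc.prems by (cases p) auto
  with Suc.prems have kP: "k < P" by simp
  have b_nz: "b + of_nat u \<noteq> 0" if "u + k + 1 < 2 * p" for u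
    using nz[of "u + k + 1"] that by (simp add: b_def algebra_simps)
  \<comment> \<open>Both \<open>A * E * B\<close> and \<open>b * D * G\<close> are the product of
    \<open>b\<close>, ..., \<open>b + of_nat p\<close>. Up to sign, the new summand splits into
    \<open>Y / (b * D)\<close>, which cancels the previous partial sum, and
    \<open>Z / (D * G)\<close>, which is the next one.\<close>
  define A where "A = pochhammer b (Suc k)"
  define B where "B = pochhammer (b + of_nat k + 2) (P - k)"
  define D where "D = pochhammer (b + 1) P"
  define E where "E = b + of_nat k + 1"
  define G where "G = b + of_nat p"
  define X Y Z where "X = (of_nat (p choose Suc k) :: 'a)" and "Y = (of_nat (P choose k) :: 'a)"
    and "Z = (of_nat (P choose Suc k) :: 'a)"
  have bD: "b * D = pochhammer b p"
    by (simp add: D_def P pochhammer_rec)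
  have DG: "D * G = pochhammer (b + 1) p"
    by (simp add: D_def G_def P pochhammer_Suc algebra_simps)
  have AEB: "A * E * B = b * D * G"
  proof -
    have "A * E * B = pochhammer b (Suc (Suc k)) * B"
      by (simp add: A_def E_def pochhammer_Suc algebra_simps)
    also have "\<dots> = pochhammer b (Suc (Suc k) + (P - k))"
      unfolding pochhammer_product' by (simp add: B_def algebra_simps)
    also have "\<dots> = pochhammer b (Suc p)"
      using kP by (simp add: P)
    also have "\<dots> = b * D * G"
      by (simp add: bD G_def pochhammer_Suc)
    finally show ?thesis .
  qed
  have "pochhammer b (Suc p) \<noteq> 0"
    using b_nz kP P by (auto simp: pochhammer_eq_0_iff eq_neg_iff_add_eq_0)
  then have "b * D * G \<noteq> 0"
    by (simp add: bD G_def pochhammer_Suc)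
  then have nonzero: "A \<noteq> 0" "E \<noteq> 0" "B \<noteq> 0" "b \<noteq> 0" "D \<noteq> 0" "G \<noteq> 0"
    using AEB by auto
  have "Suc k * (p choose Suc k) = p * (P choose k)"
    by (simp only: P Suc_times_binomial)
  then have "(of_nat k + 1) * X = of_nat p * Y"
    unfolding X_def Y_def by (metis of_nat_mult of_nat_Suc add.commute)
  moreover have "X = Y + Z"
    by (simp add: X_def Y_def Z_def P)
  ultimately have XE: "X * E = Y * G + Z * b"
    by (simp add: E_def G_def algebra_simps)
  have "X / (A * B) = X * E / (A * E * B)"
    using nonzero by simp
  also have "\<dots> = Y / (b * D) + Z / (D * G)"
    unfolding AEB XE using nonzero by (simp add: field_simps)
  finally have step: "X / (A * B) = Y / (b * D) + Z / (D * G)" .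
  have "(\<Sum>q\<le>Suc k. (- 1) ^ q * of_nat (p choose q) /
            (pochhammer (a + of_nat q) q * pochhammer (a + 1 + 2 * of_nat q) (p - q)))
      = (- 1) ^ k * Y / pochhammer b p + (- 1) ^ Suc k * X / (A * B)"
    using Suc by (simp add: P X_def Y_def A_def B_def b_def algebra_simps)
  also have "\<dots> = (- 1) ^ Suc k * Z / (D * G)"
    unfolding bD[symmetric] times_divide_eq_right[symmetric] step by (simp add: ring_distribs)
  finally show ?case
    by (simp add: DG P Z_def b_def algebra_simps)
qed

text \<open>The partial sum up to \<open>p - 1\<close> is the negative of the last summand: both
  have the denominator \<open>pochhammer (a + of_nat p) p\<close>.\<close>

lemma sum_well_poised:
  fixes a :: "'a::field_char_0"
  assumes "p > 0" and nz: "\<And>u. 1 \<le> u \<Longrightarrow> u < 2 * p \<Longrightarrow> a + of_nat u \<noteq> 0"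
  shows "(\<Sum>q\<le>p. (- 1) ^ q * of_nat (p choose q) /
            (pochhammer (a + of_nat q) q * pochhammer (a + 1 + 2 * of_nat q) (p - q))) = 0"
proof -
  obtain P where P: "p = Suc P" using assms(1) by (cases p) auto
  show ?thesis
    using sum_well_poised_partial[of P p a] nz
    by (simp add: P algebra_simps)
qed

section \<open>Convolution of the polynomials at \<open>x\<close> and \<open>- x\<close>\<close>

text \<open>This is the coefficient of \<open>(x gchoose j) * ((- x) gchoose t)\<close> in the
  convolution, with \<open>j + q\<close> as the first degree.\<close>

lemma sum_hahn_coeff_mult:
  assumes nz: "\<And>u. 1 \<le> u \<Longrightarrow> u < 2 * r \<Longrightarrow> \<alpha> + c - N + real u \<noteq> 0"
    and r: "r = j + t + p"
  shows "(\<Sum>q\<le>p. hahn_coeff \<alpha> c N (j + q) j *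
             hahn_coeff (- \<alpha>) (1 - c - real r) (1 - N + real r) (r - (j + q)) t) = of_bool (p = 0)"
proof (cases "p = 0")
  case True
  then show ?thesis by (simp add: hahn_coeff_def r)
next
  case False
  define a where "a = \<alpha> + c - N + 2 * real j"
  define K where "K = pochhammer (1 - N + real j) p * pochhammer (c + real j) p * (- 1) ^ p / fact p"
  have "hahn_coeff \<alpha> c N (j + q) j *
          hahn_coeff (- \<alpha>) (1 - c - real r) (1 - N + real r) (r - (j + q)) t =
        K * ((- 1) ^ q * of_nat (p choose q) /
          (pochhammer (a + real q) q * pochhammer (a + 1 + 2 * real q) (p - q)))"
    if "q \<le> p" for q
  proof -
    define v where "v = p - q"
    have p: "p = q + v" using that by (simp add: v_def)
    \<comment> \<open>Reversed and negated, the numerator factors of the second coefficient continue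
      those of the first. Their product is therefore free of \<open>q\<close> and goes into
      \<open>K\<close>.\<close>
    have p1: "pochhammer (1 - (1 - N + real r) + real t) v
        = (- 1) ^ v * pochhammer (1 - N + real j + real q) v"
      using pochhammer_minus[of "real j + real p - N" v] by (simp add: r p algebra_simps)
    have p2: "pochhammer (1 - c - real r + real t) v = (- 1) ^ v * pochhammer (c + real j + real q) v"
      using pochhammer_minus[of "c + real j + real p - 1" v] by (simp add: r p algebra_simps)
    have p3: "pochhammer (real (t + v) + - \<alpha> + (1 - c - real r) - (1 - N + real r) + real t) v
        = (- 1) ^ v * pochhammer (a + 1 + 2 * real q) v"
      using pochhammer_minus[of "a + 2 * real p - real v" v] by (simp add: r p a_def algebra_simps)
    have k: "r - (j + q) = t + v" by (simp add: r p)
    have c2: "hahn_coeff (- \<alpha>) (1 - c - real r) (1 - N + real r) (r - (j + q)) t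
        = (- 1) ^ v * pochhammer (1 - N + real j + real q) v * pochhammer (c + real j + real q) v
          / (pochhammer (a + 1 + 2 * real q) v * fact v)"
      unfolding hahn_coeff_def k diff_add_inverse p1 p2 p3
      by (cases "even v") simp_all
    have c1: "hahn_coeff \<alpha> c N (j + q) j
        = pochhammer (1 - N + real j) q * pochhammer (c + real j) q
          / (pochhammer (a + real q) q * fact q)"
      by (simp add: hahn_coeff_def a_def algebra_simps)
    have sign: "(- 1) ^ v = ((- 1) ^ p * (- 1) ^ q :: real)"
      by (simp add: p power_add)
    have binom: "real (p choose q) = fact p / (fact q * fact v)"
      using that by (simp add: binomial_fact v_def)
    show ?thesis
      unfolding c1 c2 K_def binom v_def[symmetric] sign
      by (simp add: p pochhammer_product' field_simps)
  qed
  then have "(\<Sum>q\<le>p. hahn_coeff \<alpha> c N (j + q) j *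
             hahn_coeff (- \<alpha>) (1 - c - real r) (1 - N + real r) (r - (j + q)) t)
      = K * (\<Sum>q\<le>p. (- 1) ^ q * of_nat (p choose q) /
          (pochhammer (a + real q) q * pochhammer (a + 1 + 2 * real q) (p - q)))"
    unfolding sum_distrib_left by (intro sum.cong) auto
  also have "\<dots> = 0"
    using sum_well_poised[of p a] nz[of "2 * j + _"] False
    by (simp add: a_def r algebra_simps)
  finally show ?thesis using False by simp
qed

lemma hahn_convolution:
  fixes x :: "'a::real_field"
  assumes nz: "\<And>u. 1 \<le> u \<Longrightarrow> u < 2 * r \<Longrightarrow> \<alpha> + c - N + real u \<noteq> 0"
  shows "(\<Sum>l\<le>r. hahn \<alpha> c N l x * hahn (- \<alpha>) (1 - c - real r) (1 - N + real r) (r - l) (- x))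
    = of_bool (r = 0)"
proof -
  define f where "f l j t = hahn_coeff \<alpha> c N l j *
    hahn_coeff (- \<alpha>) (1 - c - real r) (1 - N + real r) (r - l) t" for l j t
  define g where "g j t = (x gchoose j) * ((- x) gchoose t)" for j t
  have "(\<Sum>l\<le>r. hahn \<alpha> c N l x * hahn (- \<alpha>) (1 - c - real r) (1 - N + real r) (r - l) (- x))
      = (\<Sum>l\<le>r. \<Sum>j\<le>l. \<Sum>t\<le>r - l. of_real (f l j t) * g j t)"
    unfolding hahn_altdef sum_product f_def g_def by (intro sum.cong refl) (simp add: mult_ac)
  also have "\<dots> = (\<Sum>(l, j, t)\<in>(SIGMA l:{..r}. {..l} \<times> {..r - l}). of_real (f l j t) * g j t)"
    by (simp add: sum.Sigma sum.cartesian_product)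
  \<comment> \<open>With \<open>q = l - j\<close> innermost, the binomials leave the inner
    sum.\<close>
  also have "\<dots> = (\<Sum>(j, t, q)\<in>(SIGMA j:{..r}. SIGMA t:{..r - j}. {..r - j - t}).
                    of_real (f (j + q) j t) * g j t)"
    by (rule sum.reindex_bij_witness[of _ "\<lambda>(j, t, q). (j + q, j, t)" "\<lambda>(l, j, t). (j, t, l - j)"]) auto
  also have "\<dots> = (\<Sum>j\<le>r. \<Sum>t\<le>r - j. \<Sum>q\<le>r - j - t. of_real (f (j + q) j t) * g j t)"
    by (simp add: sum.Sigma)
  also have "\<dots> = (\<Sum>j\<le>r. \<Sum>t\<le>r - j. if t = r - j then g j t else 0)"
  proof (intro sum.cong refl)
    fix j t assume "j \<in> {..r}" "t \<in> {..r - j}"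
    then have r: "r = j + t + (r - j - t)" and iff: "r - j - t = 0 \<longleftrightarrow> t = r - j" by auto
    have "(\<Sum>q\<le>r - j - t. of_real (f (j + q) j t) * g j t)
        = of_real (\<Sum>q\<le>r - j - t. f (j + q) j t) * g j t"
      by (simp add: sum_distrib_right)
    also have "(\<Sum>q\<le>r - j - t. f (j + q) j t) = of_bool (r - j - t = 0)"
      unfolding f_def using nz r by (rule sum_hahn_coeff_mult)
    finally show "(\<Sum>q\<le>r - j - t. of_real (f (j + q) j t) * g j t) = (if t = r - j then g j t else 0)"
      unfolding iff by auto
  qed
  also have "\<dots> = (\<Sum>j=0..r. g j (r - j))"
    by (simp add: atLeast0AtMost)
  \<comment> \<open>Vandermonde's convolution gives \<open>(x + - x) gchoose r\<close>, that is,
    \<open>0 gchoose r\<close>.\<close>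
  also have "\<dots> = of_bool (r = 0)"
    unfolding g_def gbinomial_Vandermonde by (cases r) auto
  finally show ?thesis .
qed

section \<open>Determinants: row differences, complementary minors, reflection\<close>

text \<open>Newton's formula factors the matrix into the unitriangular binomial matrix
  \<open>L\<close> and the matrix \<open>D\<close> of differences.\<close>

lemma hahn_det_differences:
  fixes x :: "'a::real_field"
  shows "hahn_det \<alpha> c N n m x = det (mat n n (\<lambda>(i, j).
    if i \<le> m + j then hahn \<alpha> (c + real i) (N - real i) (m + j - i) x else 0))"
proof -
  define L where "L = mat n n (\<lambda>(i, p). of_nat (i choose p) :: 'a)"
  define D where "D = mat n n (\<lambda>(i, j).
    if i \<le> m + j then hahn \<alpha> (c + real i) (N - real i) (m + j - i) x else 0)"
  have carrier: "L \<in> carrier_mat n n" "D \<in> carrier_mat n n"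
    by (auto simp: L_def D_def)
  have "mat n n (\<lambda>(i, j). hahn \<alpha> c N (m + j) (x + of_nat i)) = L * D"
  proof (rule eq_matI, goal_cases)
    case (1 i j)
    then have ij: "i < n" "j < n" by (auto simp: L_def D_def)
    have "(L * D) $$ (i, j) = (\<Sum>p\<in>{0..<n}. of_nat (i choose p) *
       (if p \<le> m + j then hahn \<alpha> (c + real p) (N - real p) (m + j - p) x else 0))"
      using ij by (simp add: L_def D_def scalar_prod_def)
    also have "\<dots> = (\<Sum>p\<le>i. of_nat (i choose p) *
       (if p \<le> m + j then hahn \<alpha> (c + real p) (N - real p) (m + j - p) x else 0))"
      using ij by (intro sum.mono_neutral_right) auto
    finally show ?case using ij by (simp add: hahn_plus_of_nat)
  qed (auto simp: L_def D_def)
  then have "hahn_det \<alpha> c N n m x = det L * det D"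
    unfolding hahn_det_def using det_mult[OF carrier] by simp
  also have "det L = 1"
    by (subst det_lower_triangular[OF _ carrier(1)]) (auto simp: L_def prod_list_diag_prod)
  finally show ?thesis by (simp add: D_def)
qed

text \<open>Let \<open>Q\<close> consist of the last \<open>m\<close> columns of \<open>W\<close>
  followed by unit columns. Its determinant is the minor of \<open>W\<close>, while
  \<open>M * Q\<close> consists of unit columns followed by the last \<open>n\<close> columns of
  \<open>M\<close>.\<close>

lemma det_complementary_minor:
  fixes M W :: "'a::idom mat"
  assumes M: "M \<in> carrier_mat (n + m) (n + m)" and W: "W \<in> carrier_mat (n + m) (n + m)"
    and inverse: "M * W = 1\<^sub>m (n + m)"
  shows "det (mat n n (\<lambda>(i, j). M $$ (i, m + j)))
    = (- 1) ^ (n * m) * det M * det (mat m m (\<lambda>(i, j). W $$ (i, n + j)))"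
proof -
  define Q where "Q = mat (n + m) (n + m) (\<lambda>(i, j). if j < m then W $$ (i, n + j) else of_bool (i = j))"
  have Q: "Q \<in> carrier_mat (n + m) (n + m)" by (simp add: Q_def)
  have MQ: "(M * Q) $$ (i, j) = (if j < m then of_bool (i = n + j) else M $$ (i, j))"
    if ij: "i < n + m" "j < n + m" for i j
  proof (cases "j < m")
    case True
    have "(M * Q) $$ (i, j) = (M * W) $$ (i, n + j)"
      using ij True M W by (simp add: Q_def scalar_prod_def)
    then show ?thesis using ij True by (simp add: inverse)
  next
    case False
    then have "(M * Q) $$ (i, j) = (\<Sum>l\<in>{0..<n + m}. M $$ (i, l) * of_bool (l = j))"
      using ij M by (simp add: Q_def scalar_prod_def)
    also have "\<dots> = M $$ (i, j)"
      using ij by (subst sum.remove[of _ j]) auto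
    finally show ?thesis using False by simp
  qed
  have "det Q = det (four_block_mat (mat m m (\<lambda>(i, j). W $$ (i, n + j))) (0\<^sub>m m n)
           (mat n m (\<lambda>(i, j). W $$ (m + i, n + j))) (1\<^sub>m n))"
    by (intro arg_cong[of _ _ det] eq_matI) (auto simp: Q_def)
  also have "\<dots> = det (mat m m (\<lambda>(i, j). W $$ (i, n + j)))"
    by (subst det_four_block_mat_upper_right_zero) auto
  finally have detQ: "det Q = det (mat m m (\<lambda>(i, j). W $$ (i, n + j)))" .
  have "det M * det Q = det (M * Q)"
    using M Q by (simp add: det_mult)
  \<comment> \<open>Moving the unit columns to the right produces the sign and leaves a block
    triangular matrix.\<close>
  also have "\<dots> = (- 1) ^ (n * m) * det (mat (n + m) (n + m) (\<lambda>(i, j).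
      (M * Q) $$ (i, if j < n then j + m else j - n)))"
    using M Q by (intro det_swap_cols) auto
  also have "mat (n + m) (n + m) (\<lambda>(i, j). (M * Q) $$ (i, if j < n then j + m else j - n))
      = four_block_mat (mat n n (\<lambda>(i, j). M $$ (i, m + j))) (0\<^sub>m n m)
          (mat m n (\<lambda>(i, j). M $$ (n + i, m + j))) (1\<^sub>m m)"
    by (rule eq_matI) (auto simp: MQ add.commute simp del: index_mult_mat)
  also have "det \<dots> = det (mat n n (\<lambda>(i, j). M $$ (i, m + j)))"
    by (subst det_four_block_mat_upper_right_zero) auto
  finally have "det M * det (mat m m (\<lambda>(i, j). W $$ (i, n + j)))
      = (- 1) ^ (n * m) * det (mat n n (\<lambda>(i, j). M $$ (i, m + j)))"
    by (simp add: detQ)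
  then have "(- 1) ^ (n * m) * (det M * det (mat m m (\<lambda>(i, j). W $$ (i, n + j))))
      = (- 1) ^ (n * m) * ((- 1) ^ (n * m) * det (mat n n (\<lambda>(i, j). M $$ (i, m + j))))"
    by simp
  then show ?thesis
    by (simp add: mult.assoc[symmetric] power_mult_distrib[symmetric])
qed

text \<open>With the reversal matrix \<open>R\<close>, the reflected matrix is
  \<open>R * (R * A)\<^sup>T\<close>, and \<open>R * R\<close> is the identity.\<close>

lemma det_antitranspose:
  fixes A :: "'a::comm_ring_1 mat"
  assumes A: "A \<in> carrier_mat k k"
  shows "det (mat k k (\<lambda>(i, j). A $$ (k - Suc j, k - Suc i))) = det A"
proof -
  define R :: "'a mat" where "R = mat k k (\<lambda>(i, j). of_bool (j = k - Suc i))"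
  have R: "R \<in> carrier_mat k k" by (simp add: R_def)
  have RB: "(R * B) $$ (i, j) = B $$ (k - Suc i, j)"
    if "B \<in> carrier_mat k k" "i < k" "j < k" for B i j
  proof -
    have "(R * B) $$ (i, j) = (\<Sum>l\<in>{0..<k}. of_bool (l = k - Suc i) * B $$ (l, j))"
      using that by (simp add: R_def scalar_prod_def)
    also have "\<dots> = B $$ (k - Suc i, j)"
      using that by (subst sum.remove[of _ "k - Suc i"]) auto
    finally show ?thesis .
  qed
  have RR: "R * R = 1\<^sub>m k"
  proof (rule eq_matI, goal_cases)
    case (1 i j)
    then show ?case using RB[OF R, of i j] by (auto simp: R_def simp del: index_mult_mat)
  qed (use R in auto)
  have "R * (R * A)\<^sup>T = mat k k (\<lambda>(i, j). A $$ (k - Suc j, k - Suc i))"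
  proof (rule eq_matI, goal_cases)
    case (1 i j)
    then show ?case using RB[of "(R * A)\<^sup>T" i j] RB[OF A, of j "k - Suc i"] A R
      by (auto simp del: index_mult_mat(1))
  qed (use R A in auto)
  then have "det (mat k k (\<lambda>(i, j). A $$ (k - Suc j, k - Suc i))) = det (R * (R * A)\<^sup>T)"
    by simp
  also have "\<dots> = det R * (det R * det A)"
    using R A by (subst det_mult[of _ k]) (auto simp: det_mult[of _ k] det_transpose[of _ k])
  also have "\<dots> = det (R * R) * det A"
    using R by (simp add: det_mult mult.assoc)
  finally show ?thesis by (simp add: RR)
qed

section \<open>Nonvanishing denominators and the duality\<close>

text \<open>The denominators in degree \<open>k\<close> consist of the factors
  \<open>\<alpha> + c - N + real u\<close> with \<open>k \<le> u\<close> and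
  \<open>u < 2 * k\<close>, so it suffices to find such a degree in the given range.\<close>

lemma hahn_defined_nonzero:
  assumes "\<And>k. k \<in> {m..<m + n} \<Longrightarrow> hahn_defined \<alpha> c N k"
    and "1 \<le> n" "m \<le> u" "1 \<le> u" "u + 2 < 2 * (m + n)"
  shows "\<alpha> + c - N + real u \<noteq> 0"
proof -
  \<comment> \<open>The least degree from \<open>m\<close> on with \<open>u < 2 * k\<close>. For
    \<open>j = u - k\<close> the number in question is the first factor of the denominator.\<close>
  define k where "k = max m (u div 2 + 1)"
  have k: "k \<in> {m..<m + n}" "k \<le> u" "u - k < k"
    using assms(2-) by (auto simp: k_def max_def)
  have "pochhammer (real k + \<alpha> + c - N + real (u - k)) (k - (u - k)) \<noteq> 0"
    using assms(1)[OF k(1)] k(3) unfolding hahn_defined_def by (meson less_imp_le)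
  moreover have "real k + \<alpha> + c - N + real (u - k) = \<alpha> + c - N + real u"
    using k by simp
  moreover have "k - (u - k) \<noteq> 0" using k by simp
  ultimately show ?thesis
    by (metis pochhammer_0_left)
qed

theorem corollary5p4:
  fixes \<alpha> c N :: real and n m :: nat and x :: "'a::real_field"
  assumes "\<And>k::nat. 1 \<le> k \<Longrightarrow> \<alpha> + c - N \<noteq> - real k"
    and "\<And>k. k \<in> {m..<m + n} \<Longrightarrow>
           hahn_defined \<alpha> (c - real n - real m) (N + real n + real m) k"
    and "\<And>k. k \<in> {n..<n + m} \<Longrightarrow> hahn_defined (- \<alpha>) (2 - c) (- N) k"
  shows "hahn_det \<alpha> (c - real n - real m) (N + real n + real m) n m x
           = (- 1) ^ (n * m) * hahn_det (- \<alpha>) (2 - c) (- N) m n (- x)"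
proof -
  define C where "C = c - real n - real m"
  define N' where "N' = N + real n + real m"
  \<comment> \<open>In general neither hypothesis alone covers all denominators of the matrix and its inverse.\<close>
  have nz: "\<alpha> + C - N' + real u \<noteq> 0" if u: "1 \<le> u" "u + 2 < 2 * (n + m)" for u
  proof (cases "1 \<le> n \<and> m \<le> u")
    case True
    with u assms(2) show ?thesis
      unfolding C_def N'_def by (intro hahn_defined_nonzero) (auto simp: add.commute)
  next
    case False
    \<comment> \<open>This is the negative of the number in question: passing to the right-hand
      parameters reflects \<open>u\<close> to \<open>2 * (n + m) - u - 2\<close>.\<close>
    have "- \<alpha> + (2 - c) - (- N) + real (2 * (n + m) - u - 2) \<noteq> 0"
      using u False assms(3) by (intro hahn_defined_nonzero[of n m]) auto
    then show ?thesis
      using u by (simp add: C_def N'_def of_nat_diff)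
  qed
  define M where "M = mat (n + m) (n + m) (\<lambda>(i, l).
    if i \<le> l then hahn \<alpha> (C + real i) (N' - real i) (l - i) x else 0)"
  define W where "W = mat (n + m) (n + m) (\<lambda>(i, l).
    if i \<le> l then hahn (- \<alpha>) (1 - C - real l) (1 - N' + real l) (l - i) (- x) else 0)"
  have M: "M \<in> carrier_mat (n + m) (n + m)" and W: "W \<in> carrier_mat (n + m) (n + m)"
    by (auto simp: M_def W_def)
  have "M * W = 1\<^sub>m (n + m)"
  proof (rule eq_matI, goal_cases)
    case (1 i r)
    then have ir: "i < n + m" "r < n + m" by auto
    have MW: "(M * W) $$ (i, r) = (\<Sum>l\<in>{0..<n + m}. M $$ (i, l) * W $$ (l, r))"
      using ir M W by (simp add: scalar_prod_def)
    show ?case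
    proof (cases "i \<le> r")
      case False
      then have "M $$ (i, l) * W $$ (l, r) = 0" if "l < n + m" for l
        using that ir by (auto simp: M_def W_def)
      then have "(M * W) $$ (i, r) = 0"
        unfolding MW by (intro sum.neutral) auto
      then show ?thesis using False ir by auto
    next
      case True
      \<comment> \<open>The parameters of \<open>W\<close> depend only on the column
        \<open>r\<close>, so they fit the convolution of total degree \<open>r - i\<close> started
        at \<open>C + real i\<close>, \<open>N' - real i\<close>.\<close>
      have shift: "1 - (C + real i) - real (r - i) = 1 - C - real r"
        "1 - (N' - real i) + real (r - i) = 1 - N' + real r"
        using True by auto
      have "(M * W) $$ (i, r) = (\<Sum>l\<in>{i..r}. M $$ (i, l) * W $$ (l, r))"
        unfolding MW using ir by (intro sum.mono_neutral_right) (auto simp: M_def W_def)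
      also have "\<dots> = (\<Sum>l\<le>r - i. M $$ (i, i + l) * W $$ (i + l, r))"
        using True by (intro sum.reindex_bij_witness[of _ "\<lambda>l. i + l" "\<lambda>l. l - i"]) auto
      also have "\<dots> = (\<Sum>l\<le>r - i. hahn \<alpha> (C + real i) (N' - real i) l x *
          hahn (- \<alpha>) (1 - (C + real i) - real (r - i)) (1 - (N' - real i) + real (r - i)) (r - i - l) (- x))"
        unfolding shift using ir True by (intro sum.cong refl) (auto simp: M_def W_def)
      also have "\<dots> = of_bool (r - i = 0)"
      proof (rule hahn_convolution)
        \<comment> \<open>Since \<open>r < n + m\<close>, the shifted index \<open>2 * i + u\<close>
          is at most \<open>2 * (n + m) - 3\<close>, the bound in \<open>nz\<close>.\<close>
        fix u assume "1 \<le> u" "u < 2 * (r - i)"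
        then show "\<alpha> + (C + real i) - (N' - real i) + real u \<noteq> 0"
          using nz[of "2 * i + u"] ir by (simp add: algebra_simps)
      qed
      finally show ?thesis using ir True by auto
    qed
  qed (use M W in auto)
  note minor = det_complementary_minor[OF M W this]
  have "det M = 1"
    by (subst det_upper_triangular[OF _ M])
      (auto simp: M_def upper_triangular_def prod_list_diag_prod)
  moreover have "mat n n (\<lambda>(i, j). M $$ (i, m + j)) = mat n n (\<lambda>(i, j).
    if i \<le> m + j then hahn \<alpha> (C + real i) (N' - real i) (m + j - i) x else 0)"
    by (rule eq_matI) (auto simp: M_def)
  moreover have "det (mat m m (\<lambda>(i, j). W $$ (i, n + j))) = hahn_det (- \<alpha>) (2 - c) (- N) m n (- x)"
  proof -
    \<comment> \<open>The reflected entry comes from column \<open>l = n + m - 1 - i\<close> of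
      \<open>W\<close>, where \<open>1 - C - l\<close> is \<open>2 - c + i\<close> and
      \<open>1 - N' + l\<close> is \<open>- N - i\<close>. This is the differenced form of the
      right-hand determinant.\<close>
    have "mat m m (\<lambda>(i, j). mat m m (\<lambda>(i, j). W $$ (i, n + j)) $$ (m - Suc j, m - Suc i))
      = mat m m (\<lambda>(i, j). if i \<le> n + j
          then hahn (- \<alpha>) (2 - c + real i) (- N - real i) (n + j - i) (- x) else 0)"
    proof (rule eq_matI, goal_cases)
      case (1 i j)
      then have "m - Suc j \<le> n + (m - Suc i) \<longleftrightarrow> i \<le> n + j"
        and "n + (m - Suc i) - (m - Suc j) = n + j - i"
        and "real (m - Suc i) = real m - real i - 1"
        by auto
      with 1 show ?case
        by (simp add: W_def C_def N'_def algebra_simps)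
    qed auto
    then show ?thesis
      by (subst det_antitranspose[symmetric]) (auto simp: hahn_det_differences)
  qed
  ultimately show ?thesis
    using minor hahn_det_differences[of \<alpha> C N' n m x] by (simp add: C_def N'_def)
qed

end
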